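(* There exists a set $V\subset\mathbb{R}$ that is both a Vitali set and a Bernstein set. That is, $|V\cap(x+\mathbb{Q})|=1$ for every $x\in\mathbb{R}$, and for every perfect set $P\subset\mathbb{R}$ we have $P\cap V\neq\emptyset$ and $P\not\subset V$.
   Context: We work in ZFC. Let $\sim$ be the equivalence relation on $\mathbb{R}$ given by $x\sim y \leftrightarrow x-y\in\mathbb{Q}$; the equivalence class of $x$ is $[x]_\sim=x+\mathbb{Q}$. A Vitali set is a selector of the partition of $\mathbb{R}$ induced by $\sim$, i.e. a set $V\subset\mathbb{R}$ with $|V\cap[x]_\sim|=1$ for each $x\in\mathbb{R}$. A perfect set is a nonempty closed subset of $\mathbb{R}$ without isolated points. A Bernstein set is a subset of $\mathbb{R}$ that intersects every perfect set but does not contain any perfect set. *)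

theory Defs
  imports "HOL-Analysis.Analysis"
begin

definition rat_equiv :: "(real \<times> real) set" where
  "rat_equiv = {(x, y). x - y \<in> \<rat>}"

definition Vitali_set :: "real set \<Rightarrow> bool" where
  "Vitali_set V \<longleftrightarrow> (\<forall>x. card (V \<inter> rat_equiv `` {x}) = 1)"

definition perfect_set :: "real set \<Rightarrow> bool" where
  "perfect_set P \<longleftrightarrow> P \<noteq> {} \<and> closed P \<and> \<not> (\<exists>x. x isolated_in P)"

definition Bernstein_set :: "real set \<Rightarrow> bool" where
  "Bernstein_set B \<longleftrightarrow>
     (\<forall>P. perfect_set P \<longrightarrow> P \<inter> B \<noteq> {}) \<and> \<not> (\<exists>P. perfect_set P \<and> P \<subseteq> B)"

lemma equiv_rat_equiv: "equiv UNIV rat_equiv"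
proof (rule equivI)
  show "refl rat_equiv" by (simp add: refl_on_def rat_equiv_def)
  show "sym rat_equiv"
    by (auto simp: sym_def rat_equiv_def) (metis Rats_minus_iff minus_diff_eq)
  show "trans rat_equiv"
  proof (rule transI)
    fix x y z assume "(x, y) \<in> rat_equiv" "(y, z) \<in> rat_equiv"
    then have "(x - y) + (y - z) \<in> \<rat>" by (intro Rats_add) (auto simp: rat_equiv_def)
    then show "(x, z) \<in> rat_equiv" by (simp add: rat_equiv_def)
  qed
qed simp

lemma rat_equiv_class: "rat_equiv `` {x} = (\<lambda>q. x + q) ` \<rat>"
proof (intro set_eqI iffI)
  fix y assume "y \<in> rat_equiv `` {x}"
  then have "y - x \<in> \<rat>"
    by (auto simp: rat_equiv_def) (metis Rats_minus_iff minus_diff_eq)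
  then show "y \<in> (\<lambda>q. x + q) ` \<rat>" by (intro image_eqI[of _ _ "y - x"]) auto
qed (auto simp: rat_equiv_def)

end

(* Enumerate the perfect sets along a well-order of minimal type. Every perfect set P has the
   cardinality of the continuum, hence meets continuum many classes mod Q (these are countable),
   while fewer than continuum many classes were used before P. So one can assign to the perfect
   sets pairwise distinct classes meeting them, and a Vitali set V can be chosen to meet every
   perfect set. Such a V contains no perfect set P: it meets the perfect set P + 1, say in p + 1
   with p in P, and if P were contained in V then p and p + 1 would be equivalent elements of V. *)

theory Submission
  imports Defs
begin

lemma lepoll_iff_card_of_ordLeq: "A \<lesssim> B \<longleftrightarrow> (card_of A, card_of B) \<in> ordLeq"
  by (simp add: lepoll_def card_of_ordLeq)

text \<open>Transfinite recursion along \<open>card_of I\<close>, a well-order of minimal type on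
  \<open>I\<close>: fewer than \<open>|I|\<close> values have been taken before stage
  \<open>i\<close>, so they cannot exhaust \<open>A i\<close>.\<close>

lemma lepoll_imp_distinct_representatives:
  assumes "\<And>i. i \<in> I \<Longrightarrow> I \<lesssim> A i"
  obtains f where "inj_on f I" "\<And>i. i \<in> I \<Longrightarrow> f i \<in> A i"
proof -
  define r where "r = card_of I"
  have fld: "Field r = I"
    by (simp add: r_def Field_card_of)
  have wo: "Well_order r"
    unfolding r_def by (rule card_of_Well_order)
  have co: "Card_order r"
    unfolding r_def by (rule card_of_Card_order)
  have wf: "wf (r - Id)"
    using wo by (simp add: well_order_on_def)
  \<comment> \<open>The recursion principle asks for a value at every index of the type; guarding by
    \<open>i \<in> I\<close> makes the demand vacuous outside \<open>I\<close>.\<close>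
  have "\<exists>y. i \<in> I \<longrightarrow> y \<in> A i \<and> (\<forall>j. (j, i) \<in> r - Id \<longrightarrow> y \<noteq> f j)" for i and f :: "'a \<Rightarrow> 'b"
  proof (cases "i \<in> I")
    case True
    have "\<not> A i \<subseteq> f ` underS r i"
    proof
      assume "A i \<subseteq> f ` underS r i"
      then have "I \<lesssim> underS r i"
        by (meson assms True lepoll_trans subset_image_lepoll)
      then have "(card_of I, card_of (underS r i)) \<in> ordLeq"
        by (simp add: lepoll_iff_card_of_ordLeq)
      moreover have "(card_of (underS r i), card_of I) \<in> ordLess"
        using card_of_underS[OF co, of i] True fld by (simp add: r_def)
      ultimately show False
        using not_ordLess_ordLeq by blast
    qed
    then show ?thesis
      by (auto simp: underS_def)
  qed simp
  then have "\<exists>f. \<forall>i. i \<in> I \<longrightarrow> f i \<in> A i \<and> (\<forall>j. (j, i) \<in> r - Id \<longrightarrow> f i \<noteq> f j)"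
    using dependent_wf_choice[OF wf,
      of "\<lambda>f i y. i \<in> I \<longrightarrow> y \<in> A i \<and> (\<forall>j. (j, i) \<in> r - Id \<longrightarrow> y \<noteq> f j)"] by simp
  then obtain f where f: "\<And>i. i \<in> I \<Longrightarrow> f i \<in> A i"
    "\<And>i j. i \<in> I \<Longrightarrow> (j, i) \<in> r - Id \<Longrightarrow> f i \<noteq> f j"
    by blast
  \<comment> \<open>Of two distinct indices one precedes the other, so avoiding all earlier values
    already gives injectivity.\<close>
  have "total_on I r"
    using wo by (simp add: fld well_order_on_def linear_order_on_def)
  then have "inj_on f I"
    using f(2) unfolding inj_on_def total_on_def by (metis DiffI pair_in_Id_conv)
  with f(1) that show thesis
    by blast
qed

lemma uncountable_lepoll_image_countable_fibres:
  assumes "uncountable A" and fib: "\<And>y. countable {x \<in> A. f x = y}"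
  shows "A \<lesssim> f ` A"
proof -
  have A: "A = (\<Union>y\<in>f ` A. {x \<in> A. f x = y})"
    by auto
  have inf: "infinite (f ` A)"
  proof
    assume "finite (f ` A)"
    then have "countable (\<Union>y\<in>f ` A. {x \<in> A. f x = y})"
      by (rule countable_UN[OF countable_finite fib])
    with A \<open>uncountable A\<close> show False
      by argo
  qed
  have "(card_of {x \<in> A. f x = y}, card_of (f ` A)) \<in> ordLeq" for y
  proof -
    have "{x \<in> A. f x = y} \<lesssim> (UNIV :: nat set)"
      using fib countable_def by (metis lepoll_def subset_UNIV)
    also have "(UNIV :: nat set) \<lesssim> f ` A"
      using inf infinite_le_lepoll by blast
    finally show ?thesis
      by (simp add: lepoll_iff_card_of_ordLeq)
  qed
  then have "(card_of (\<Union>y\<in>f ` A. {x \<in> A. f x = y}), card_of (f ` A)) \<in> ordLeq"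
    using inf by (intro card_of_UNION_ordLeq_infinite) (auto simp: card_of_mono1)
  then have "(\<Union>y\<in>f ` A. {x \<in> A. f x = y}) \<lesssim> f ` A"
    by (simp only: lepoll_iff_card_of_ordLeq)
  with A show ?thesis
    by argo
qed

text \<open>A closed set is determined by the members of a countable base that are disjoint from it,
  since these cover its complement. This codes closed sets injectively by sets of naturals.\<close>

lemma closed_sets_lepoll_reals:
  "{S :: 'a :: second_countable_topology set. closed S} \<lesssim> (UNIV :: real set)"
proof -
  obtain B :: "'a set set" where B: "countable B"
    "\<And>U. open U \<Longrightarrow> \<exists>\<U>. \<U> \<subseteq> B \<and> U = \<Union> \<U>"
    using univ_second_countable by metis
  define code where "code S = to_nat_on B ` {U \<in> B. U \<inter> S = {}}" for S
  have decode: "S = - \<Union> {U \<in> B. U \<inter> S = {}}" if "closed S" for S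
    using B(2)[of "- S"] that by blast
  have "S = T" if "closed S" "closed T" "code S = code T" for S T
  proof -
    have "{U \<in> B. U \<inter> S = {}} = {U \<in> B. U \<inter> T = {}}"
      using that(3) unfolding code_def
      by (subst (asm) inj_on_image_eq_iff[OF inj_on_to_nat_on[OF B(1)]]) auto
    then have "- \<Union> {U \<in> B. U \<inter> S = {}} = - \<Union> {U \<in> B. U \<inter> T = {}}"
      by (rule arg_cong)
    then show ?thesis
      using decode[OF that(1)] decode[OF that(2)] by argo
  qed
  then have "inj_on code {S. closed S}"
    by (simp add: inj_on_def)
  then have "{S :: 'a set. closed S} \<lesssim> (UNIV :: nat set set)"
    unfolding lepoll_def by blast
  then show ?thesis
    using nat_sets_eqpoll_reals lepoll_trans2 by blast
qed

lemma reals_lepoll_perfect_set: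
  assumes "perfect_set P"
  shows "(UNIV :: real set) \<lesssim> P"
proof (rule lepoll_perfect_set)
  show "completely_metrizable_space (euclidean :: real topology) \<or>
      locally_compact_space (euclidean :: real topology) \<and> Hausdorff_space (euclidean :: real topology)"
    by (simp add: completely_metrizable_space_euclidean)
  \<comment> \<open>Closedness puts all limit points into \<open>P\<close>, and absence of isolated
    points makes every point of \<open>P\<close> a limit point.\<close>
  have "euclidean derived_set_of P = {x. x islimpt P}"
    unfolding set_eq_iff in_derived_set_of islimpt_def by simp blast
  also have "\<dots> = P"
    using assms unfolding perfect_set_def isolated_in_islimpt_iff closed_limpt by blast
  finally show "euclidean derived_set_of P = P" .
qed (use assms in \<open>simp add: perfect_set_def\<close>)

lemma perfect_set_translation:
  assumes "perfect_set P"
  shows "perfect_set ((+) a ` P)"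
proof -
  have "x - a isolated_in P" if "x isolated_in (+) a ` P" for x
  proof -
    obtain T where x: "x \<in> (+) a ` P" and T: "open T" "T \<inter> (+) a ` P = {x}"
      using \<open>x isolated_in (+) a ` P\<close> by (rule isolated_inE)
    show ?thesis
    proof (rule isolated_inI)
      show "x - a \<in> P"
        using x by auto
      show "open ((+) (- a) ` T)"
        using T(1) by (rule open_translation)
      show "(+) (- a) ` T \<inter> P = {x - a}"
      proof (intro set_eqI iffI)
        fix y assume "y \<in> (+) (- a) ` T \<inter> P"
        then have "a + y \<in> T \<inter> (+) a ` P"
          by auto
        then show "y \<in> {x - a}"
          using T(2) by auto
      next
        fix y assume "y \<in> {x - a}"
        moreover have "x - a \<in> (+) (- a) ` T"
          using T(2) by (intro image_eqI[of _ _ x]) auto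
        ultimately show "y \<in> (+) (- a) ` T \<inter> P"
          using \<open>x - a \<in> P\<close> by simp
      qed
    qed
  qed
  then show ?thesis
    using assms by (auto simp: perfect_set_def closed_translation)
qed

text \<open>The reals serve as the intermediate cardinal: they bound the number of closed sets from
  above and inject into \<open>P\<close>, whose points fall into countable classes.\<close>

lemma perfect_set_lepoll_classes:
  assumes "perfect_set P"
  shows "{P. perfect_set P} \<lesssim> (\<lambda>x. rat_equiv `` {x}) ` P"
proof -
  have "{P. perfect_set P} \<lesssim> {S :: real set. closed S}"
    by (rule subset_imp_lepoll) (auto simp: perfect_set_def)
  also have "\<dots> \<lesssim> (UNIV :: real set)"
    by (rule closed_sets_lepoll_reals)
  also have le: "(UNIV :: real set) \<lesssim> P"
    using assms by (rule reals_lepoll_perfect_set)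
  also have "P \<lesssim> (\<lambda>x. rat_equiv `` {x}) ` P"
  proof (rule uncountable_lepoll_image_countable_fibres)
    show "uncountable P"
      using le countable_lepoll uncountable_UNIV_real by blast
    show "countable {x \<in> P. rat_equiv `` {x} = C}" for C
    \<comment> \<open>The fibre lemma quantifies over arbitrary \<open>C\<close>; if
      \<open>C\<close> is not a class, its fibre is empty.\<close>
    proof (cases "\<exists>x. C = rat_equiv `` {x}")
      case True
      then have "countable C"
        by (auto simp: rat_equiv_class countable_rat)
      moreover have "{x \<in> P. rat_equiv `` {x} = C} \<subseteq> C"
        using equiv_class_self[OF equiv_rat_equiv] by auto
      ultimately show ?thesis
        by (rule countable_subset[rotated])
    next
      case False
      then have "{x \<in> P. rat_equiv `` {x} = C} = {}"
        by blast
      then show ?thesis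
        by (metis countable_empty)
    qed
  qed
  finally show ?thesis .
qed

text \<open>Distinct classes are disjoint, so the point selected from another class cannot fall into
  the given one.\<close>

lemma Vitali_set_range_selector:
  assumes "\<And>C. C \<in> UNIV // rat_equiv \<Longrightarrow> s C \<in> C"
  shows "Vitali_set (s ` (UNIV // rat_equiv))"
  unfolding Vitali_set_def
proof
  fix x
  have C: "rat_equiv `` {x} \<in> UNIV // rat_equiv"
    by (simp add: quotientI)
  have "D = rat_equiv `` {x}" if "D \<in> UNIV // rat_equiv" "s D \<in> rat_equiv `` {x}" for D
    using quotient_disj[OF equiv_rat_equiv that(1) C] assms[OF that(1)] that(2) by blast
  then have "s ` (UNIV // rat_equiv) \<inter> rat_equiv `` {x} = {s (rat_equiv `` {x})}"
    using assms C by blast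
  then show "card (s ` (UNIV // rat_equiv) \<inter> rat_equiv `` {x}) = 1"
    by simp
qed

lemma Vitali_set_eqI:
  assumes "Vitali_set V" "x \<in> V" "y \<in> V" "x - y \<in> \<rat>"
  shows "x = y"
proof -
  have "card (V \<inter> rat_equiv `` {x}) = 1"
    using assms(1) by (simp add: Vitali_set_def)
  then obtain z where "V \<inter> rat_equiv `` {x} = {z}"
    by (rule card_1_singletonE)
  moreover have "x \<in> rat_equiv `` {x}" "y \<in> rat_equiv `` {x}"
    using assms(4) by (auto simp: rat_equiv_def)
  ultimately show ?thesis
    using assms(2,3) by (metis IntI singletonD)
qed

lemma Vitali_set_imp_Bernstein_set:
  assumes V: "Vitali_set V" and meets: "\<And>P. perfect_set P \<Longrightarrow> P \<inter> V \<noteq> {}"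
  shows "Bernstein_set V"
proof -
  have "\<not> P \<subseteq> V" if P: "perfect_set P" for P
  proof
    assume "P \<subseteq> V"
    obtain p where "p \<in> P" "1 + p \<in> V"
      using meets[OF perfect_set_translation[OF P, of 1]] by auto
    then show False
      using Vitali_set_eqI[OF V, of "1 + p" p] \<open>P \<subseteq> V\<close> by auto
  qed
  then show ?thesis
    using meets by (auto simp: Bernstein_set_def)
qed

theorem theorem2p2:
  shows "\<exists>V :: real set. Vitali_set V \<and> Bernstein_set V"
proof -
  obtain f where inj: "inj_on f {P. perfect_set P}"
    and f: "\<And>P. P \<in> {P. perfect_set P} \<Longrightarrow> f P \<in> (\<lambda>x. rat_equiv `` {x}) ` P"
    by (rule lepoll_imp_distinct_representatives[of "{P. perfect_set P}"
          "\<lambda>P. (\<lambda>x. rat_equiv `` {x}) ` P"])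
      (use perfect_set_lepoll_classes in auto)
  \<comment> \<open>As \<open>f\<close> is injective, a class \<open>C\<close> is reserved for at
    most one perfect set, which meets it; a point common to both satisfies the demand. In an
    unreserved class any point will do.\<close>
  have "\<exists>y. y \<in> C \<and> (\<forall>P. perfect_set P \<and> f P = C \<longrightarrow> y \<in> P)"
    if C: "C \<in> UNIV // rat_equiv" for C
  proof (cases "\<exists>P. perfect_set P \<and> f P = C")
    case True
    then obtain P where P: "perfect_set P" "f P = C"
      by blast
    then obtain y where "y \<in> P" "C = rat_equiv `` {y}"
      using f by blast
    moreover have "Q = P" if "perfect_set Q" "f Q = C" for Q
      using inj P that by (auto dest: inj_onD)
    ultimately show ?thesis
      using equiv_class_self[OF equiv_rat_equiv] by blast
  next
    case False
    then show ?thesis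
      using C in_quotient_imp_non_empty[OF equiv_rat_equiv] by blast
  qed
  then obtain s where s: "\<And>C. C \<in> UNIV // rat_equiv \<Longrightarrow> s C \<in> C"
    "\<And>C P. C \<in> UNIV // rat_equiv \<Longrightarrow> perfect_set P \<Longrightarrow> f P = C \<Longrightarrow> s C \<in> P"
    by metis
  let ?V = "s ` (UNIV // rat_equiv)"
  have V: "Vitali_set ?V"
    using s(1) by (rule Vitali_set_range_selector)
  have "P \<inter> ?V \<noteq> {}" if "perfect_set P" for P
  proof -
    \<comment> \<open>The point \<open>s (f P)\<close> selected from the class reserved for
      \<open>P\<close> witnesses the intersection.\<close>
    have "f P \<in> UNIV // rat_equiv"
      using f that by (auto simp: quotient_def)
    then show ?thesis
      using s(2) that by blast
  qed
  with V have "Bernstein_set ?V"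
    by (rule Vitali_set_imp_Bernstein_set)
  with V show ?thesis
    by blast
qed

end
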